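(* Let $C_1$ and $C_2$ be clones on $\{0,1\}$, and let $K$ be a set of Boolean functions. Then the following statements are equivalent: (a) $K$ is a $(C_1,C_2)$-clonoid. (b) $K^{\mathrm{n}}$ is a $(C_1^{\mathrm{d}},C_2)$-clonoid. (c) $\overline{K}$ is a $(C_1,C_2^{\mathrm{d}})$-clonoid. (d) $K^{\mathrm{d}}$ is a $(C_1^{\mathrm{d}},C_2^{\mathrm{d}})$-clonoid.
   Context: A Boolean function is a map $f \colon \{0,1\}^n \to \{0,1\}$ for some integer $n \geq 1$ (its arity). If $f$ is $n$-ary and $g_1,\dots,g_n$ are $m$-ary, then $f(g_1,\dots,g_n)$ is the $m$-ary function $\mathbf{a} \mapsto f(g_1(\mathbf{a}),\dots,g_n(\mathbf{a}))$. For sets $F, G$ of Boolean functions, $FG$ is the set of all composites $f(g_1,\dots,g_n)$ with $f \in F$ of some arity $n$ and $g_1,\dots,g_n \in G$ all of a common arity. A clone on $\{0,1\}$ is a set $C$ of Boolean functions containing all projections and satisfying $CC \subseteq C$. For clones $C_1,C_2$ on $\{0,1\}$, a (possibly empty) set $K$ of Boolean functions is a $(C_1,C_2)$-clonoid if $KC_1 \subseteq K$ and $C_2K \subseteq K$. For $a \in \{0,1\}$, $\overline{a}=1-a$, and for tuples $\overline{\mathbf{a}}=(\overline{a_1},\dots,\overline{a_n})$. For an $n$-ary $f$, the negation $\overline{f}$, inner negation $f^{\mathrm{n}}$, and dual $f^{\mathrm{d}}$ are given by $\overline{f}(\mathbf{a})=\overline{f(\mathbf{a})}$, $f^{\mathrm{n}}(\mathbf{a})=f(\overline{\mathbf{a}})$,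 $f^{\mathrm{d}}(\mathbf{a})=\overline{f(\overline{\mathbf{a}})}$. For a set $C$ of Boolean functions, $\overline{C}=\{\overline{f}: f\in C\}$, $C^{\mathrm{n}}=\{f^{\mathrm{n}}: f\in C\}$, $C^{\mathrm{d}}=\{f^{\mathrm{d}}: f\in C\}$. (The dual $C^{\mathrm d}$ of a clone $C$ is again a clone.) *)

theory Defs
  imports "HOL-Library.FuncSet"
begin

text \<open>The set \<open>{0,1}\<close> is the type \<^typ>\<open>bool\<close>, and \<open>{0,1}\<^sup>n\<close> is the set of Boolean lists of
  length \<open>n\<close>. A Boolean function carries its arity \<open>n \<ge> 1\<close>; values on lists of any other length
  are fixed to \<^term>\<open>undefined\<close>, so that equality of Boolean functions is equality of arity and of
  values on \<open>{0,1}\<^sup>n\<close>.\<close>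

definition tuples :: "nat \<Rightarrow> bool list set" where
  "tuples n = {a. length a = n}"

typedef boolean_function =
  "{(n :: nat, f :: bool list \<Rightarrow> bool). n \<ge> 1 \<and> f \<in> extensional (tuples n)}"
  by (rule exI[of _ "(1, \<lambda>_. undefined)"]) (simp add: extensional_def)

definition arity :: "boolean_function \<Rightarrow> nat" where
  "arity f = fst (Rep_boolean_function f)"

definition app :: "boolean_function \<Rightarrow> bool list \<Rightarrow> bool" where
  "app f = snd (Rep_boolean_function f)"

text \<open>\<open>bfun n \<phi>\<close> is the \<open>n\<close>-ary function \<open>a \<mapsto> \<phi> a\<close>; it is meaningful only for \<open>n \<ge> 1\<close>.\<close>

definition bfun :: "nat \<Rightarrow> (bool list \<Rightarrow> bool) \<Rightarrow> boolean_function" where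
  "bfun n \<phi> = Abs_boolean_function (n, restrict \<phi> (tuples n))"

lemma arity_ge_1: "arity f \<ge> 1"
  using Rep_boolean_function[of f] by (auto simp: arity_def)

lemma arity_bfun: "n \<ge> 1 \<Longrightarrow> arity (bfun n \<phi>) = n"
  by (simp add: arity_def bfun_def Abs_boolean_function_inverse)

lemma app_bfun: "n \<ge> 1 \<Longrightarrow> length a = n \<Longrightarrow> app (bfun n \<phi>) a = \<phi> a"
  by (simp add: app_def bfun_def Abs_boolean_function_inverse tuples_def)

lemma boolean_function_eqI:
  assumes "arity f = arity g" and "\<And>a. length a = arity f \<Longrightarrow> app f a = app g a"
  shows "f = g"
proof -
  have "app f \<in> extensional (tuples (arity f))" "app g \<in> extensional (tuples (arity g))"
    using Rep_boolean_function[of f] Rep_boolean_function[of g]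
    by (auto simp: app_def arity_def)
  then have "app f = app g"
    using assms by (intro extensionalityI[of _ "tuples (arity f)"]) (auto simp: tuples_def)
  then show ?thesis
    using assms(1) by (metis Rep_boolean_function_inject app_def arity_def prod.expand)
qed

definition projection :: "nat \<Rightarrow> nat \<Rightarrow> boolean_function" where
  "projection n i = bfun n (\<lambda>a. a ! i)"

text \<open>\<open>compose m f [g\<^sub>1, \<dots>, g\<^sub>n]\<close> is \<open>f(g\<^sub>1, \<dots>, g\<^sub>n)\<close>, where \<open>f\<close> is \<open>n\<close>-ary and all \<open>g\<^sub>i\<close> are \<open>m\<close>-ary.\<close>

definition compose :: "nat \<Rightarrow> boolean_function \<Rightarrow> boolean_function list \<Rightarrow> boolean_function" where
  "compose m f gs = bfun m (\<lambda>a. app f (map (\<lambda>g. app g a) gs))"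

definition set_compose ::
    "boolean_function set \<Rightarrow> boolean_function set \<Rightarrow> boolean_function set" where
  "set_compose F G = {compose m f gs | m f gs.
     f \<in> F \<and> length gs = arity f \<and> (\<forall>g \<in> set gs. g \<in> G \<and> arity g = m)}"

definition clone :: "boolean_function set \<Rightarrow> bool" where
  "clone C \<longleftrightarrow> (\<forall>n \<ge> 1. \<forall>i < n. projection n i \<in> C) \<and> set_compose C C \<subseteq> C"

definition clonoid ::
    "boolean_function set \<Rightarrow> boolean_function set \<Rightarrow> boolean_function set \<Rightarrow> bool" where
  "clonoid C\<^sub>1 C\<^sub>2 K \<longleftrightarrow> clone C\<^sub>1 \<and> clone C\<^sub>2 \<and> set_compose K C\<^sub>1 \<subseteq> K \<and> set_compose C\<^sub>2 K \<subseteq> K"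

definition negation :: "boolean_function \<Rightarrow> boolean_function" where
  "negation f = bfun (arity f) (\<lambda>a. \<not> app f a)"

definition inner_negation :: "boolean_function \<Rightarrow> boolean_function" where
  "inner_negation f = bfun (arity f) (\<lambda>a. app f (map Not a))"

definition dual :: "boolean_function \<Rightarrow> boolean_function" where
  "dual f = bfun (arity f) (\<lambda>a. \<not> app f (map Not a))"

end

(* The three operations are injective and preserve arities, and composition commutes with them
   in the sense that dual f (dual g_1, ..., dual g_n) is the dual of f(g_1, ..., g_n), and
   similarly for suitable pairs of operations applied to f and to the g_i. Hence the closure
   conditions that define a clonoid are carried over to the images and back. *)

theory Submission
  imports Defs
begin

lemma arity_negation [simp]: "arity (negation f) = arity f"
  by (simp add: negation_def arity_bfun[OF arity_ge_1])

lemma arity_inner_negation [simp]: "arity (inner_negation f) = arity f"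
  by (simp add: inner_negation_def arity_bfun[OF arity_ge_1])

lemma arity_dual [simp]: "arity (dual f) = arity f"
  by (simp add: dual_def arity_bfun[OF arity_ge_1])

lemma app_negation: "length a = arity f \<Longrightarrow> app (negation f) a = (\<not> app f a)"
  by (simp add: negation_def app_bfun[OF arity_ge_1])

lemma app_inner_negation:
  "length a = arity f \<Longrightarrow> app (inner_negation f) a = app f (map Not a)"
  by (simp add: inner_negation_def app_bfun[OF arity_ge_1])

lemma app_dual: "length a = arity f \<Longrightarrow> app (dual f) a = (\<not> app f (map Not a))"
  by (simp add: dual_def app_bfun[OF arity_ge_1])

text \<open>The shape that two successive flips of the input take once the simplifier has fused the
  maps. It makes \<open>inner_negation\<close> and \<open>dual\<close> involutions.\<close>

lemma map_Not_comp_Not [simp]: "map (Not \<circ> Not) a = a"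
  by (simp add: comp_def)

lemma negation_negation: "negation (negation f) = f"
  by (rule boolean_function_eqI) (simp_all add: app_negation)

lemma inner_negation_inner_negation: "inner_negation (inner_negation f) = f"
  by (rule boolean_function_eqI) (simp_all add: app_inner_negation)

lemma dual_dual: "dual (dual f) = f"
  by (rule boolean_function_eqI) (simp_all add: app_dual)

lemma inj_negation: "inj negation"
  by (rule inj_on_inverseI) (rule negation_negation)

lemma inj_inner_negation: "inj inner_negation"
  by (rule inj_on_inverseI) (rule inner_negation_inner_negation)

lemma inj_dual: "inj dual"
  by (rule inj_on_inverseI) (rule dual_dual)

lemma arity_compose: "m \<ge> 1 \<Longrightarrow> arity (compose m f gs) = m"
  by (simp add: compose_def arity_bfun)

lemma app_compose:
  "m \<ge> 1 \<Longrightarrow> length a = m \<Longrightarrow> app (compose m f gs) a = app f (map (\<lambda>g. app g a) gs)"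
  by (simp add: compose_def app_bfun)

context
  fixes m :: nat and f :: boolean_function and gs :: "boolean_function list"
  assumes m: "m \<ge> 1"
    and len: "length gs = arity f"
    and ar: "\<forall>g \<in> set gs. arity g = m"
begin

lemma compose_negation_left: "compose m (negation f) gs = negation (compose m f gs)"
  by (rule boolean_function_eqI)
    (use m len in \<open>simp_all add: arity_compose app_compose app_negation\<close>)

lemma compose_inner_negation_right:
  "compose m f (map inner_negation gs) = inner_negation (compose m f gs)"
  by (rule boolean_function_eqI)
    (use m ar in \<open>auto simp: arity_compose app_compose app_inner_negation
      intro!: arg_cong[where f = "app f"]\<close>)

text \<open>A dual is an outer negation together with an input flip. The outer negations of the
  inner functions cancel against the input flip of the outer function, so only the flip of the
  common argument survives.\<close>

lemma compose_inner_negation_dual: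
  "compose m (inner_negation f) (map dual gs) = inner_negation (compose m f gs)"
  by (rule boolean_function_eqI)
    (use m len ar in \<open>auto simp: arity_compose app_compose app_inner_negation app_dual
      intro!: arg_cong[where f = "app f"]\<close>)

text \<open>Here the negated inner values undo the input flip in \<open>dual f\<close>, and its
  outer negation remains.\<close>

lemma compose_dual_negation:
  "compose m (dual f) (map negation gs) = negation (compose m f gs)"
  by (rule boolean_function_eqI)
    (use m len ar in \<open>auto simp: arity_compose app_compose app_negation app_dual
      intro!: arg_cong[where f = "app f"]\<close>)

lemma compose_dual_dual: "compose m (dual f) (map dual gs) = dual (compose m f gs)"
  by (rule boolean_function_eqI)
    (use m len ar in \<open>auto simp: arity_compose app_compose app_dual
      intro!: arg_cong[where f = "app f"]\<close>)

end

text \<open>Lifts an identity between single composites to sets. Having an equality instead of an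
  inclusion lets one rewriting serve both directions of each equivalence.\<close>

lemma set_compose_image:
  assumes s: "\<And>f. arity (s f) = arity f" and t: "\<And>g. arity (t g) = arity g"
    and st: "\<And>m f gs. m \<ge> 1 \<Longrightarrow> length gs = arity f \<Longrightarrow> \<forall>g \<in> set gs. arity g = m \<Longrightarrow>
      compose m (s f) (map t gs) = u (compose m f gs)"
  shows "set_compose (s ` F) (t ` G) = u ` set_compose F G"
proof -
  \<comment> \<open>\<open>set_compose\<close> puts no bound on \<open>m\<close>, while
    \<open>st\<close> needs a positive one. As the outer arity is at least 1, some inner function
    exists, and \<open>m\<close> is its arity.\<close>
  have pos: "m \<ge> 1"
    if "length gs = arity f" "\<forall>g \<in> set gs. arity g = m" for m f and gs :: "boolean_function list"
  proof -
    have "gs \<noteq> []"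
      using that(1) arity_ge_1[of f] by auto
    then have "arity (hd gs) = m"
      using that(2) by simp
    then show ?thesis
      using arity_ge_1[of "hd gs"] by simp
  qed
  show ?thesis
  proof (intro subset_antisym subsetI)
    fix h assume "h \<in> set_compose (s ` F) (t ` G)"
    then obtain m f hs where h: "h = compose m (s f) hs" and f: "f \<in> F"
      and len: "length hs = arity (s f)" and hs: "\<forall>g \<in> set hs. g \<in> t ` G \<and> arity g = m"
      unfolding set_compose_def by blast
    \<comment> \<open>Passing through \<open>lists\<close> yields preimages under \<open>t\<close>
      for all entries at once, as one list \<open>gs\<close>.\<close>
    from hs have "hs \<in> lists (t ` G)"
      by blast
    then obtain gs where gs: "gs \<in> lists G" "hs = map t gs"
      by (auto simp: lists_image)
    have ar: "length gs = arity f" "\<forall>g \<in> set gs. arity g = m"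
      using len hs gs s t by auto
    then have "h = u (compose m f gs)"
      using h gs(2) st pos by simp
    moreover have "compose m f gs \<in> set_compose F G"
      using f gs(1) ar unfolding set_compose_def by blast
    ultimately show "h \<in> u ` set_compose F G"
      by blast
  next
    fix h assume "h \<in> u ` set_compose F G"
    then obtain m f gs where h: "h = u (compose m f gs)" and f: "f \<in> F"
      and ar: "length gs = arity f" "\<forall>g \<in> set gs. arity g = m" and gs: "\<forall>g \<in> set gs. g \<in> G"
      unfolding set_compose_def by blast
    have "h = compose m (s f) (map t gs)"
      using h st ar pos by simp
    moreover have "length (map t gs) = arity (s f)"
        "\<forall>g \<in> set (map t gs). g \<in> t ` G \<and> arity g = m"
      using ar gs s t by auto
    ultimately show "h \<in> set_compose (s ` F) (t ` G)"
      using f unfolding set_compose_def by blast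
  qed
qed

lemma set_compose_negation_left: "set_compose (negation ` F) G = negation ` set_compose F G"
  using set_compose_image[of negation id negation F G] by (simp add: compose_negation_left)

lemma set_compose_inner_negation_right:
  "set_compose F (inner_negation ` G) = inner_negation ` set_compose F G"
  using set_compose_image[of id inner_negation inner_negation F G]
  by (simp add: compose_inner_negation_right)

lemma set_compose_inner_negation_dual:
  "set_compose (inner_negation ` F) (dual ` G) = inner_negation ` set_compose F G"
  by (rule set_compose_image) (simp_all add: compose_inner_negation_dual)

lemma set_compose_dual_negation:
  "set_compose (dual ` F) (negation ` G) = negation ` set_compose F G"
  by (rule set_compose_image) (simp_all add: compose_dual_negation)

lemma set_compose_dual_dual: "set_compose (dual ` F) (dual ` G) = dual ` set_compose F G"
  by (rule set_compose_image) (simp_all add: compose_dual_dual)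

text \<open>The outer negation cancels the flip of the selected coordinate. Hence dualizing a clone
  loses no projection.\<close>

lemma dual_projection: "i < n \<Longrightarrow> dual (projection n i) = projection n i"
  by (rule boolean_function_eqI) (simp_all add: projection_def arity_bfun app_dual app_bfun)

lemma clone_dual:
  assumes "clone C"
  shows "clone (dual ` C)"
proof -
  have "projection n i \<in> dual ` C" if "n \<ge> 1" "i < n" for n i
  proof -
    have "projection n i \<in> C"
      using assms that by (simp add: clone_def)
    then show ?thesis
      using dual_projection[OF that(2)] by (metis imageI)
  qed
  moreover have "set_compose (dual ` C) (dual ` C) \<subseteq> dual ` C"
    using assms by (auto simp: clone_def set_compose_dual_dual)
  ultimately show ?thesis
    by (simp add: clone_def)
qed

theorem proposition3p5:
  fixes C\<^sub>1 C\<^sub>2 K :: "boolean_function set"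
  assumes "clone C\<^sub>1" and "clone C\<^sub>2"
  shows "(clonoid C\<^sub>1 C\<^sub>2 K \<longleftrightarrow> clonoid (dual ` C\<^sub>1) C\<^sub>2 (inner_negation ` K)) \<and>
         (clonoid C\<^sub>1 C\<^sub>2 K \<longleftrightarrow> clonoid C\<^sub>1 (dual ` C\<^sub>2) (negation ` K)) \<and>
         (clonoid C\<^sub>1 C\<^sub>2 K \<longleftrightarrow> clonoid (dual ` C\<^sub>1) (dual ` C\<^sub>2) (dual ` K))"
  \<comment> \<open>\<open>clone_dual\<close> settles the clone conditions. The image laws turn each
    closure condition on the transformed sets into an inclusion between two images under the same
    map, and injectivity of that map reduces it to the original condition on
    \<open>K\<close>.\<close>
  using assms
  by (simp add: clonoid_def clone_dual set_compose_inner_negation_dual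
      set_compose_inner_negation_right set_compose_negation_left set_compose_dual_negation
      set_compose_dual_dual inj_image_subset_iff inj_negation inj_inner_negation inj_dual)

end
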